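(* In general, for two-dimensional diffusion without consumption or generation terms, for any interval $I=[a^{i-1}+i,\,a^i]$ of the past history (as defined in the context), the Grünwald-Letnikov discretization with adaptive time step memory is given by $$\frac{u^{k+1}_{j,l}-u^{k}_{j,l}}{\Delta_t}=\alpha\frac{\Delta_t^{\gamma-1}}{\Delta_x^2}\Bigg[\sum_{n=0}^{a}\psi(\gamma,n)\,\delta^{k-n}_{j,l}+\sum_{i=2}^{i_{max}}\ \sum_{m_i=a^{i-1}+i}^{a^i}(2i-1)\,\psi(\gamma,m_i)\,\delta^{k-m_i}_{j,l}+\sum_{p=m_{max}+i_{max}}^{k}\psi(\gamma,p)\,\delta^{k-p}_{j,l}\Bigg],$$ where $p\in\mathbb{N}_1$, and for each $i$ (i.e. for each interval) $$M=\{\,m_i=a^{i-1}+(2i-1)\eta-i+1 : \eta\in\mathbb{N}_1 \ \text{and}\ m_i\le m_{max}\,\}$$ is the set of time points over which $\psi(\gamma,m)\,\delta^{k-m}_{j,l}$ is evaluated (so the index $m_i$ of the inner sum takes only values in $M$). Since the time point $k$ may be less than the full length of the last interval $I_{max}$, $m_{max}$, with $|m_{max}|\le|k-i_{max}|$, represents the maximum value in $I_{max}$ that is evaluated, i.e. the last element in the set $M$ for $I_{max}$.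
   Context: $\mathbb{N}_1$ denotes the natural numbers beginning from one. Grid: $u^{k}_{j,l}$ is the value at time index $k$ and grid point $(j,l)$ of a two-dimensional, equally spaced grid with spacing $\Delta_x$ in both directions; $\Delta_t$ is the time step; $\alpha$ is the diffusion coefficient; $0<\gamma\le 2$ is the order of the time-fractional diffusion equation $\partial u/\partial t=\alpha D^{1-\gamma}\nabla^2u$, where $D^{1-\gamma}$ is the Grünwald-Letnikov fractional derivative in time. The finite difference kernel is $$\delta^{k-m}_{j,l}=u^{k-m}_{j+1,l}+u^{k-m}_{j-1,l}-4u^{k-m}_{j,l}+u^{k-m}_{j,l+1}+u^{k-m}_{j,l-1}.$$ Weights: $\psi(\gamma,m)=(-1)^m\binom{1-\gamma}{m}=\frac{(-1)^m\Gamma(2-\gamma)}{m!\,\Gamma(2-\gamma-m)}$, equivalently $\psi(\gamma,0)=1$ and $\psi(\gamma,m)=-\psi(\gamma,m-1)\frac{2-\gamma-m}{m}$. Full discretization (without consumption or generation terms): $\frac{u^{k+1}_{j,l}-u^{k}_{j,l}}{\Delta_t}=\alpha\frac{\Delta_t^{\gamma-1}}{\Delta_x^2}\sum_{m=0}^{k}\psi(\gamma,m)\,\delta^{k-m}_{j,l}$, where $m$ counts time steps backwards from the current time step $k$. Intervals: let $k$ be the current iterative time step and let $a$ be an arbitrary time point in the history of the system backwards from $k$. The first interval backwards from $k$, the base interval, is $[0,a]$. For $i\in\mathbb{N}_1$, $i\ne1$, an interval of the past history is $I=[a^{i-1}+i,\,a^i]$. Let $i_{max}$ be the value of $i$ such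 that $k\in I_{max}=[a^{i_{max}-1}+i_{max},\,a^{i_{max}}]$. The complete set of intervals is $\zeta=\{I=[a^{i-1}+i,a^i]: i\in\mathbb{N}_1,\ i\ne1,\ i\le i_{max}\}$. The set of distances at which the corresponding intervals in $\zeta$ are sampled is $D=\{d=2i-1: i\in\mathbb{N}_1,\ i\ne1\}$. Adaptive time step memory: in the sum over the past history, all time points in the base interval $[0,a]$ are used. In each subsequent interval, neighboring prior time points are grouped into increments of length $d$, only one value per increment (its median) is used, and it is weighted according to the length $d$ of the increment to account for the skipped points. The final point(s) of the backwards summation are still incorporated even if the chosen $a$ does not generate a final increment that ends on $k$. *)

theory Defs
  imports Complex_Main
begin

text \<open>A grid function \<open>u k j l\<close> is the value at time step \<open>k\<close> and grid point \<open>(j, l)\<close>.\<close>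

definition fd_kernel :: "(nat \<Rightarrow> int \<Rightarrow> int \<Rightarrow> real) \<Rightarrow> nat \<Rightarrow> int \<Rightarrow> int \<Rightarrow> real" where
  "fd_kernel u t j l =
     u t (j + 1) l + u t (j - 1) l - 4 * u t j l + u t j (l + 1) + u t j (l - 1)"

definition psi :: "real \<Rightarrow> nat \<Rightarrow> real" where
  "psi \<gamma> m = (-1) ^ m * ((1 - \<gamma>) gchoose m)"

text \<open>
  Time points \<open>m\<close> of the past history are counted backwards from the current time step \<open>k\<close>.
\<close>

definition gl_term ::
  "(nat \<Rightarrow> int \<Rightarrow> int \<Rightarrow> real) \<Rightarrow> real \<Rightarrow> nat \<Rightarrow> int \<Rightarrow> int \<Rightarrow> nat \<Rightarrow> real" where
  "gl_term u \<gamma> k j l m = psi \<gamma> m * fd_kernel u (k - m) j l"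

definition base_interval :: "nat \<Rightarrow> nat set" where
  "base_interval a = {0..a}"

definition past_interval :: "nat \<Rightarrow> nat \<Rightarrow> nat set" where
  "past_interval a i = {a ^ (i - 1) + i..a ^ i}"

definition sample_distance :: "nat \<Rightarrow> nat" where
  "sample_distance i = 2 * i - 1"

text \<open>
  The history after the time point \<open>a ^ (i - 1)\<close>, where the preceding interval (the base
  interval, if \<open>i = 2\<close>) ends, is cut into consecutive blocks of \<open>sample_distance i\<close> neighbouring
  time points; \<open>increment a i \<eta>\<close> is the block number \<open>\<eta> \<ge> 1\<close>. The left end \<open>a ^ (i - 1) + i\<close> of
  \<open>past_interval a i\<close> is the median of the first block.
\<close>

definition increment :: "nat \<Rightarrow> nat \<Rightarrow> nat \<Rightarrow> nat set" where
  "increment a i \<eta> =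
     {a ^ (i - 1) + sample_distance i * (\<eta> - 1) <.. a ^ (i - 1) + sample_distance i * \<eta>}"

definition median :: "nat set \<Rightarrow> nat" where
  "median J = (THE m. m \<in> J \<and> card {x \<in> J. x < m} = card {x \<in> J. m < x})"

text \<open>
  A block belongs to the \<open>i\<close>-th interval if its median, the one time point at which it is
  sampled, lies there. It is used only if it ends before \<open>k\<close>: this is the bound
  \<open>m\<^sub>m\<^sub>a\<^sub>x \<le> k - i\<^sub>m\<^sub>a\<^sub>x\<close> on the last sampled point, as a block with median \<open>m\<close> ends at \<open>m + i - 1\<close>.
  Hence the summation always finishes with individually evaluated points, of which \<open>k\<close> is one.
\<close>

definition increments :: "nat \<Rightarrow> nat \<Rightarrow> nat \<Rightarrow> nat set set" where
  "increments a k i =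
     {increment a i \<eta> | \<eta>. \<eta> \<ge> 1 \<and> median (increment a i \<eta>) \<in> past_interval a i \<and>
                            increment a i \<eta> \<subseteq> {..<k}}"

definition final_points :: "nat \<Rightarrow> nat \<Rightarrow> nat \<Rightarrow> nat set" where
  "final_points a k imax = {a ^ (imax - 1) <.. k} - \<Union> (increments a k imax)"

text \<open>Here \<open>imax\<close> is meant to be the index of the interval that contains \<open>k\<close>.\<close>

definition adaptive_memory_sum ::
  "(nat \<Rightarrow> int \<Rightarrow> int \<Rightarrow> real) \<Rightarrow> real \<Rightarrow> nat \<Rightarrow> nat \<Rightarrow> nat \<Rightarrow> int \<Rightarrow> int \<Rightarrow> real" where
  "adaptive_memory_sum u \<gamma> a imax k j l =
     (\<Sum>n\<in>base_interval a. gl_term u \<gamma> k j l n)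
     + (\<Sum>i=2..imax. \<Sum>J\<in>increments a k i. real (card J) * gl_term u \<gamma> k j l (median J))
     + (\<Sum>p\<in>final_points a k imax. gl_term u \<gamma> k j l p)"

text \<open>
  The full discretization has the sum of \<open>gl_term u \<gamma> k j l m\<close> over all \<open>m \<le> k\<close> in place of
  \<open>adaptive_memory_sum\<close>.
\<close>

definition adaptive_gl_discretization ::
  "(nat \<Rightarrow> int \<Rightarrow> int \<Rightarrow> real) \<Rightarrow> real \<Rightarrow> real \<Rightarrow> real \<Rightarrow> real \<Rightarrow>
     nat \<Rightarrow> nat \<Rightarrow> nat \<Rightarrow> int \<Rightarrow> int \<Rightarrow> bool" where
  "adaptive_gl_discretization u \<alpha> \<gamma> \<Delta>t \<Delta>x a imax k j l \<longleftrightarrow>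
     (u (k + 1) j l - u k j l) / \<Delta>t
       = \<alpha> * (\<Delta>t powr (\<gamma> - 1) / \<Delta>x ^ 2) * adaptive_memory_sum u \<gamma> a imax k j l"

text \<open>The subtraction does not truncate for \<open>i \<ge> 1\<close> and \<open>\<eta> \<ge> 1\<close>, since then \<open>(2 * i - 1) * \<eta> \<ge> i\<close>.\<close>

definition sample_point :: "nat \<Rightarrow> nat \<Rightarrow> nat \<Rightarrow> nat" where
  "sample_point a i \<eta> = a ^ (i - 1) + (2 * i - 1) * \<eta> - i + 1"

definition sample_set :: "nat \<Rightarrow> nat \<Rightarrow> nat \<Rightarrow> nat set" where
  "sample_set a mmax i = {sample_point a i \<eta> | \<eta>. \<eta> \<ge> 1 \<and> sample_point a i \<eta> \<le> mmax}"

text \<open>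
  \<open>mmax\<close> is the largest sample point of the interval containing \<open>k\<close> that satisfies
  \<open>\<bar>mmax\<bar> \<le> \<bar>k - imax\<bar>\<close>; it is thereby the last element of \<open>sample_set a mmax imax\<close>.
\<close>

definition is_last_sample :: "nat \<Rightarrow> nat \<Rightarrow> nat \<Rightarrow> nat \<Rightarrow> bool" where
  "is_last_sample a imax k mmax \<longleftrightarrow>
     (let C = {m \<in> past_interval a imax.
                 (\<exists>\<eta>\<ge>1. m = sample_point a imax \<eta>) \<and> \<bar>int m\<bar> \<le> \<bar>int k - int imax\<bar>}
      in mmax \<in> C \<and> (\<forall>m\<in>C. m \<le> mmax))"

end

theory Submission
  imports Defs
begin

text \<open>
  The blocks of the \<open>i\<close>-th interval have \<open>2 * i - 1\<close> points, so block number \<open>\<eta>\<close> has the median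
  \<open>sample_point a i \<eta>\<close> and ends \<open>i - 1\<close> points after it; it ends before \<open>k\<close> iff its median is at
  most \<open>k - i\<close>. In the last interval this is the bound that defines \<open>mmax\<close>, and the used blocks
  fill everything up to \<open>mmax + imax - 1\<close>. In an earlier interval the bound holds automatically:
  the medians are at most \<open>a ^ i\<close>, and \<open>a ^ i + i \<le> a ^ (imax - 1) + imax \<le> k\<close>.
\<close>

text \<open>The middle of an odd block has \<open>r\<close> points on either side. Conversely, equal
  counts below and above \<open>m\<close> give a linear equation with only one solution.\<close>

lemma median_greaterThanAtMost: "median {b<..b + (2 * r + 1)} = b + r + 1"
  unfolding median_def
proof (rule the_equality)
  have "{x \<in> {b<..b + (2 * r + 1)}. x < b + r + 1} = {b<..<b + r + 1}"
    "{x \<in> {b<..b + (2 * r + 1)}. b + r + 1 < x} = {b + r + 1<..b + (2 * r + 1)}"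
    by auto
  then show "b + r + 1 \<in> {b<..b + (2 * r + 1)} \<and>
      card {x \<in> {b<..b + (2 * r + 1)}. x < b + r + 1} =
      card {x \<in> {b<..b + (2 * r + 1)}. b + r + 1 < x}"
    by simp
next
  fix m
  assume m: "m \<in> {b<..b + (2 * r + 1)} \<and>
      card {x \<in> {b<..b + (2 * r + 1)}. x < m} = card {x \<in> {b<..b + (2 * r + 1)}. m < x}"
  then have "{x \<in> {b<..b + (2 * r + 1)}. x < m} = {b<..<m}"
    "{x \<in> {b<..b + (2 * r + 1)}. m < x} = {m<..b + (2 * r + 1)}"
    by auto
  with m have "b < m" "m \<le> b + (2 * r + 1)" "m - Suc b = b + (2 * r + 1) - m" by simp_all
  then show "m = b + r + 1" by linarith
qed

text \<open>Writing \<open>i\<close> and \<open>\<eta>\<close> as successors removes the truncated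
  subtractions before any arithmetic is done.\<close>

lemma sample_point_Suc: "sample_point a (Suc r) (Suc e) = a ^ r + (2 * r + 1) * e + r + 1"
  by (simp add: sample_point_def)

lemma increment_Suc:
  "increment a (Suc r) (Suc e) =
     {a ^ r + (2 * r + 1) * e<..a ^ r + (2 * r + 1) * e + (2 * r + 1)}"
  by (simp add: increment_def sample_distance_def ac_simps)

text \<open>A block has \<open>i - 1\<close> points on each side of its median. The sample point is
  at least \<open>i\<close>, so the subtraction does not truncate.\<close>

lemma increment_eq_sample_point:
  assumes "i \<ge> 1" "\<eta> \<ge> 1"
  shows "increment a i \<eta> = {sample_point a i \<eta> - i<..<sample_point a i \<eta> + i}"
proof -
  obtain r e where "i = Suc r" "\<eta> = Suc e"
    using assms by (metis Suc_le_D One_nat_def)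
  then show ?thesis by (auto simp: increment_Suc sample_point_Suc)
qed

lemma median_increment:
  assumes "i \<ge> 1" "\<eta> \<ge> 1"
  shows "median (increment a i \<eta>) = sample_point a i \<eta>"
proof -
  obtain r e where "i = Suc r" "\<eta> = Suc e"
    using assms by (metis Suc_le_D One_nat_def)
  then show ?thesis
    by (simp only: increment_Suc median_greaterThanAtMost sample_point_Suc)
qed

lemma card_increment: "i \<ge> 1 \<Longrightarrow> \<eta> \<ge> 1 \<Longrightarrow> card (increment a i \<eta>) = 2 * i - 1"
  by (cases \<eta>) (simp_all add: increment_def sample_distance_def)

lemma increment_subset_lessThan_iff:
  assumes "i \<ge> 1" "\<eta> \<ge> 1"
  shows "increment a i \<eta> \<subseteq> {..<k} \<longleftrightarrow> sample_point a i \<eta> + i \<le> k"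
proof
  \<comment> \<open>The last point of the block alone decides whether the block ends before
    \<open>k\<close>.\<close>
  have last: "sample_point a i \<eta> + i - 1 \<in> increment a i \<eta>"
    using assms by (auto simp: increment_eq_sample_point sample_point_def)
  assume "increment a i \<eta> \<subseteq> {..<k}"
  with last have "sample_point a i \<eta> + i - 1 < k" by blast
  then show "sample_point a i \<eta> + i \<le> k" by simp
qed (use assms in \<open>auto simp: increment_eq_sample_point\<close>)

lemma increments_eq_sample_point:
  assumes "i \<ge> 1"
  shows "increments a k i =
    increment a i ` {\<eta>. \<eta> \<ge> 1 \<and> sample_point a i \<eta> \<in> past_interval a i \<and>
                         sample_point a i \<eta> + i \<le> k}"
  using assms
  by (simp add: increments_def setcompr_eq_image median_increment increment_subset_lessThan_iff
      cong: conj_cong)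

text \<open>Summing over blocks or over their medians is the same, as \<open>median\<close> is
  injective on blocks. The hypothesis \<open>bound\<close> trades the condition on \<open>k\<close>
  for the one on \<open>mmax\<close>.\<close>

lemma sum_increments_eq:
  fixes f :: "nat \<Rightarrow> real"
  assumes i: "i \<ge> 1"
    and bound: "\<And>\<eta>. \<eta> \<ge> 1 \<Longrightarrow> sample_point a i \<eta> \<in> past_interval a i \<Longrightarrow>
                  sample_point a i \<eta> + i \<le> k \<longleftrightarrow> sample_point a i \<eta> \<le> mmax"
  shows "(\<Sum>J\<in>increments a k i. real (card J) * f (median J)) =
    (\<Sum>m\<in>{a ^ (i - 1) + i..a ^ i} \<inter> sample_set a mmax i. real (2 * i - 1) * f m)"
proof -
  have image: "{a ^ (i - 1) + i..a ^ i} \<inter> sample_set a mmax i = median ` increments a k i"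
    using i bound
    by (auto simp: increments_eq_sample_point sample_set_def past_interval_def image_image
        median_increment image_iff)
  have "inj_on median (increments a k i)"
  proof (rule inj_onI)
    fix J K assume JK: "J \<in> increments a k i" "K \<in> increments a k i" "median J = median K"
    then obtain \<eta> \<theta> where "\<eta> \<ge> 1" "J = increment a i \<eta>" "\<theta> \<ge> 1" "K = increment a i \<theta>"
      using i by (auto simp: increments_eq_sample_point)
    \<comment> \<open>A block is the symmetric interval of radius \<open>i\<close> around its
      median, hence determined by it.\<close>
    with JK(3) show "J = K"
      using i by (simp add: median_increment) (simp add: increment_eq_sample_point)
  qed
  then have "(\<Sum>m\<in>{a ^ (i - 1) + i..a ^ i} \<inter> sample_set a mmax i. real (2 * i - 1) * f m) =
      (\<Sum>J\<in>increments a k i. real (2 * i - 1) * f (median J))"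
    unfolding image by (simp add: sum.reindex)
  also have "\<dots> = (\<Sum>J\<in>increments a k i. real (card J) * f (median J))"
    by (rule sum.cong) (use i in \<open>auto simp: increments_eq_sample_point card_increment\<close>)
  finally show ?thesis by simp
qed

text \<open>Each block begins right after the previous one ends, so the first \<open>n\<close>
  blocks leave no gap.\<close>

lemma Union_increments:
  assumes "i \<ge> 1" "n \<ge> 1"
  shows "\<Union> (increment a i ` {1..n}) = {a ^ (i - 1)<..<sample_point a i n + i}"
  using assms(2)
proof (induction n rule: nat_induct_at_least)
  case base
  show ?case
    using assms(1) by (cases i) (auto simp: increment_eq_sample_point sample_point_def)
next
  case (Suc n)
  obtain r e where "i = Suc r" "n = Suc e"
    using assms(1) Suc.hyps by (metis Suc_le_D One_nat_def)
  then have "{a ^ (i - 1)<..<sample_point a i n + i} \<union> increment a i (Suc n) =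
      {a ^ (i - 1)<..<sample_point a i (Suc n) + i}"
    by (auto simp: increment_Suc sample_point_Suc)
  with Suc.IH show ?case by (simp add: atLeastAtMostSuc_conv Un_commute)
qed

lemma sample_point_le_iff:
  assumes "i \<ge> 1" "\<eta> \<ge> 1" "\<theta> \<ge> 1"
  shows "sample_point a i \<eta> \<le> sample_point a i \<theta> \<longleftrightarrow> \<eta> \<le> \<theta>"
proof -
  obtain r e t where "i = Suc r" "\<eta> = Suc e" "\<theta> = Suc t"
    using assms by (metis Suc_le_D One_nat_def)
  then show ?thesis
    by (simp add: sample_point_Suc del: mult_Suc mult_Suc_right add_mult_distrib)
qed

text \<open>Since \<open>imax \<le> k\<close>, the bound with absolute values becomes an inequality
  free of subtraction.\<close>

lemma is_last_sample_iff:
  assumes "k \<in> past_interval a imax"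
  shows "is_last_sample a imax k mmax \<longleftrightarrow>
    (\<exists>\<eta>\<ge>1. mmax = sample_point a imax \<eta>) \<and> mmax \<in> past_interval a imax \<and> mmax + imax \<le> k \<and>
    (\<forall>\<eta>\<ge>1. sample_point a imax \<eta> \<in> past_interval a imax \<longrightarrow> sample_point a imax \<eta> + imax \<le> k \<longrightarrow>
      sample_point a imax \<eta> \<le> mmax)"
proof -
  have "\<bar>int m\<bar> \<le> \<bar>int k - int imax\<bar> \<longleftrightarrow> m + imax \<le> k" for m
    using assms by (auto simp: past_interval_def)
  then show ?thesis unfolding is_last_sample_def Let_def by auto
qed

text \<open>The used blocks of the last interval are exactly those numbered from 1 to that of
  \<open>mmax\<close>, and they fill everything before \<open>mmax + imax\<close>.\<close>

lemma final_points_eq: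
  assumes i: "imax \<ge> 1" and k: "k \<in> past_interval a imax"
    and last: "is_last_sample a imax k mmax"
  shows "final_points a k imax = {mmax + imax..k}"
proof -
  obtain n where n: "n \<ge> 1" "mmax = sample_point a imax n"
    using last k by (auto simp: is_last_sample_iff)
  have "{\<eta>. \<eta> \<ge> 1 \<and> sample_point a imax \<eta> \<in> past_interval a imax \<and>
            sample_point a imax \<eta> + imax \<le> k} = {1..n}"
  proof (intro equalityI subsetI)
    fix \<eta> assume "\<eta> \<in> {1..n}"
    then have \<eta>: "\<eta> \<ge> 1" "sample_point a imax \<eta> \<le> mmax"
      using i n by (auto simp: sample_point_le_iff)
    \<comment> \<open>The first sample point is the left end of the interval, so no later one falls
      below it.\<close>
    moreover have "sample_point a imax 1 \<le> sample_point a imax \<eta>"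
      using i \<eta> by (auto simp: sample_point_le_iff)
    moreover have "sample_point a imax 1 = a ^ (imax - 1) + imax"
      using i by (simp add: sample_point_def)
    ultimately show "\<eta> \<in> {\<eta>. \<eta> \<ge> 1 \<and> sample_point a imax \<eta> \<in> past_interval a imax \<and>
        sample_point a imax \<eta> + imax \<le> k}"
      using last k by (auto simp: is_last_sample_iff past_interval_def)
  qed (use last k i n in \<open>auto simp: is_last_sample_iff sample_point_le_iff\<close>)
  then have "\<Union> (increments a k imax) = {a ^ (imax - 1)<..<mmax + imax}"
    using i n by (simp only: increments_eq_sample_point Union_increments)
  \<comment> \<open>This keeps \<open>{mmax + imax..k}\<close> inside the range from which the
    blocks are removed.\<close>
  moreover have "a ^ (imax - 1) < mmax + imax"
    using last k i by (auto simp: is_last_sample_iff past_interval_def)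
  ultimately show ?thesis unfolding final_points_def by auto
qed

text \<open>This provides the hypothesis \<open>bound\<close> of \<open>sum_increments_eq\<close>.
  For \<open>i < imax\<close> both sides are true.\<close>

lemma used_block_iff:
  assumes k: "k \<in> past_interval a imax" and last: "is_last_sample a imax k mmax"
    and i: "1 \<le> i" "i \<le> imax" and \<eta>: "\<eta> \<ge> 1" "sample_point a i \<eta> \<in> past_interval a i"
  shows "sample_point a i \<eta> + i \<le> k \<longleftrightarrow> sample_point a i \<eta> \<le> mmax"
proof (cases "i = imax")
  case True
  then show ?thesis using last k \<eta> by (auto simp: is_last_sample_iff)
next
  case False
  \<comment> \<open>For \<open>a = 0\<close> the interval would end at 0 but start at a positive
    number, so it could not contain \<open>k\<close>. Monotonicity of powers needs
    \<open>1 \<le> a\<close>.\<close>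
  have "a \<noteq> 0" using k i by (intro notI) (simp add: past_interval_def power_0_left)
  then have "a ^ i \<le> a ^ (imax - 1)" using False i by (intro power_increasing) auto
  moreover have "a ^ (imax - 1) + imax \<le> mmax" "a ^ (imax - 1) + imax \<le> k"
    using last k by (auto simp: is_last_sample_iff past_interval_def)
  ultimately show ?thesis using \<eta> i by (auto simp: past_interval_def)
qed

theorem theorem3p3:
  fixes u :: "nat \<Rightarrow> int \<Rightarrow> int \<Rightarrow> real"
    and \<alpha> \<gamma> \<Delta>t \<Delta>x :: real
    and a imax k mmax :: nat
    and j l :: int
  assumes "0 < \<gamma>" and "\<gamma> \<le> 2"
    and "\<Delta>t > 0" and "\<Delta>x > 0"
    and "imax \<ge> 2" and "k \<in> past_interval a imax"
    and "is_last_sample a imax k mmax"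
  shows "adaptive_gl_discretization u \<alpha> \<gamma> \<Delta>t \<Delta>x a imax k j l \<longleftrightarrow>
    (u (k + 1) j l - u k j l) / \<Delta>t
      = \<alpha> * (\<Delta>t powr (\<gamma> - 1) / \<Delta>x ^ 2) *
        ((\<Sum>n=0..a. psi \<gamma> n * fd_kernel u (k - n) j l)
         + (\<Sum>i=2..imax. \<Sum>m\<in>{a ^ (i - 1) + i..a ^ i} \<inter> sample_set a mmax i.
              real (2 * i - 1) * psi \<gamma> m * fd_kernel u (k - m) j l)
         + (\<Sum>p=mmax + imax..k. psi \<gamma> p * fd_kernel u (k - p) j l))"
proof -
  \<comment> \<open>The base sums agree by definition; it remains to match the inner sum of each
    interval and the range of the final sum.\<close>
  have "(\<Sum>J\<in>increments a k i. real (card J) * gl_term u \<gamma> k j l (median J)) =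
      (\<Sum>m\<in>{a ^ (i - 1) + i..a ^ i} \<inter> sample_set a mmax i.
         real (2 * i - 1) * psi \<gamma> m * fd_kernel u (k - m) j l)" if "i \<in> {2..imax}" for i
    using that used_block_iff[OF assms(6,7)]
    by (subst sum_increments_eq[where mmax = mmax]) (auto simp: gl_term_def mult.assoc)
  moreover have "final_points a k imax = {mmax + imax..k}"
    using assms(5-7) by (intro final_points_eq) auto
  ultimately show ?thesis
    by (simp add: adaptive_gl_discretization_def adaptive_memory_sum_def base_interval_def
        gl_term_def)
qed

end
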